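(* Let $G=(V,E)$ be a finite graph, let $A,B\subseteq E$ be chosen independently and uniformly at random and let $\Delta$ be the event that $A\bigtriangleup B$ is eulerian. Then $$\mathrm{Bias}(|A|\equiv |B|+1\ (\mathrm{mod}\ 3)\mid\Delta)=\mathrm{Bias}(|A|\equiv|B|+2\ (\mathrm{mod}\ 3)\mid\Delta)$$ and $$\frac{\mathrm{Bias}(|A|\equiv |B|\ (\mathrm{mod}\ 3)\mid\Delta)-\mathrm{Bias}(|A|\equiv |B|+1\ (\mathrm{mod}\ 3)\mid\Delta)}{\mathrm{Bias}(|A|\equiv |B|\ (\mathrm{mod}\ 3))-\mathrm{Bias}(|A|\equiv |B|+1\ (\mathrm{mod}\ 3))}=(-2)^{r(G)}3^{n(G)}\,T\!\left(G;-2,\tfrac{1}{3}\right).$$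
   Context: Graphs are finite; loops and parallel edges are permitted. A subset $A\subseteq E$ is identified with the subgraph $(V,A)$ of $G$; it is called eulerian if all its vertex degrees are even (a loop contributes 2 to the degree). $\bigtriangleup$ is symmetric difference of sets. For $A\subseteq E$, $r(A)=|V|-k(A)$, where $k(A)$ is the number of connected components of $(V,A)$; $r(G)=r(E)$ and $n(G)=|E|-r(G)$. The Tutte polynomial is $T(G;x,y)=\sum_{A\subseteq E}(x-1)^{r(E)-r(A)}(y-1)^{|A|-r(A)}$. For an event $\Sigma$, $\mathrm{Bias}(\Sigma)=\mathbb{P}(\Sigma)-\mathbb{P}(\overline{\Sigma})$ and $\mathrm{Bias}(\Sigma\mid\Delta)=\mathbb{P}(\Sigma\mid\Delta)-\mathbb{P}(\overline{\Sigma}\mid\Delta)$, where $\overline{\Sigma}$ is the complement of $\Sigma$. *)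

theory Defs
  imports "HOL-Probability.Probability" "HOL-Number_Theory.Cong"
begin

text \<open>Finite undirected graphs. An edge is an identity of its own, so parallel edges are
  distinct elements with the same end set; a loop at \<open>v\<close> has end set \<open>{v}\<close>.\<close>

record ('v, 'e) multigraph =
  verts :: "'v set"
  edges :: "'e set"
  ends :: "'e \<Rightarrow> 'v set"

locale finite_multigraph =
  fixes G :: "('v, 'e) multigraph"
  assumes finite_verts: "finite (verts G)"
    and finite_edges: "finite (edges G)"
    and ends_subset: "e \<in> edges G \<Longrightarrow> ends G e \<subseteq> verts G"
    and card_ends: "e \<in> edges G \<Longrightarrow> card (ends G e) \<in> {1, 2}"

text \<open>Below, \<open>A\<close> is a set of edges, standing for the spanning subgraph with edge set \<open>A\<close>.
  In the degree, the second summand makes a loop count twice.\<close>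

definition vertex_degree :: "('v, 'e) multigraph \<Rightarrow> 'e set \<Rightarrow> 'v \<Rightarrow> nat" where
  "vertex_degree G A v = card {e \<in> A. v \<in> ends G e} + card {e \<in> A. ends G e = {v}}"

definition eulerian :: "('v, 'e) multigraph \<Rightarrow> 'e set \<Rightarrow> bool" where
  "eulerian G A \<longleftrightarrow> (\<forall>v \<in> verts G. even (vertex_degree G A v))"

definition adj :: "('v, 'e) multigraph \<Rightarrow> 'e set \<Rightarrow> 'v rel" where
  "adj G A = {(u, v). \<exists>e \<in> A. ends G e = {u, v}}"

definition conn :: "('v, 'e) multigraph \<Rightarrow> 'e set \<Rightarrow> 'v rel" where
  "conn G A = (adj G A)\<^sup>* \<inter> verts G \<times> verts G"

definition num_components :: "('v, 'e) multigraph \<Rightarrow> 'e set \<Rightarrow> nat" where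
  "num_components G A = card (verts G // conn G A)"

definition edge_rank :: "('v, 'e) multigraph \<Rightarrow> 'e set \<Rightarrow> nat" where
  "edge_rank G A = card (verts G) - num_components G A"

definition graph_rank :: "('v, 'e) multigraph \<Rightarrow> nat" where
  "graph_rank G = edge_rank G (edges G)"

definition nullity :: "('v, 'e) multigraph \<Rightarrow> nat" where
  "nullity G = card (edges G) - graph_rank G"

definition tutte :: "('v, 'e) multigraph \<Rightarrow> real \<Rightarrow> real \<Rightarrow> real" where
  "tutte G x y = (\<Sum>A \<in> Pow (edges G).
     (x - 1) ^ (edge_rank G (edges G) - edge_rank G A) * (y - 1) ^ (card A - edge_rank G A))"

text \<open>None of the natural-number subtractions above ever truncates.\<close>

context finite_multigraph
begin

lemma sym_adj: "sym (adj G A)"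
  by (auto simp: adj_def sym_def insert_commute)

lemma equiv_conn: "equiv (verts G) (conn G A)"
proof (rule equivI)
  show "conn G A \<subseteq> verts G \<times> verts G" by (auto simp: conn_def)
  show "refl_on (verts G) (conn G A)" by (auto simp: conn_def refl_on_def)
  show "sym (conn G A)"
    using sym_rtrancl[OF sym_adj[of A]] by (auto simp: conn_def sym_def)
  show "trans (conn G A)" by (auto simp: conn_def trans_def)
qed

lemma finite_components: "finite (verts G // conn G A)"
  by (simp add: finite_verts quotient_def)

lemma num_components_le: "num_components G A \<le> card (verts G)"
proof -
  have "verts G // conn G A = (\<lambda>v. conn G A `` {v}) ` verts G"
    by (auto simp: quotient_def)
  then show ?thesis
    by (simp add: num_components_def card_image_le finite_verts)
qed

lemma conn_mono: "A \<subseteq> B \<Longrightarrow> conn G A \<subseteq> conn G B"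
proof -
  assume "A \<subseteq> B"
  then have "adj G A \<subseteq> adj G B" by (auto simp: adj_def)
  then have "(adj G A)\<^sup>* \<subseteq> (adj G B)\<^sup>*" by (rule rtrancl_mono)
  then show ?thesis by (auto simp: conn_def)
qed

lemma conn_Image:
  assumes "A \<subseteq> B" "v \<in> verts G"
  shows "conn G B `` (conn G A `` {v}) = conn G B `` {v}"
proof
  have "trans (conn G B)" using equiv_conn[of B] by (simp add: equiv_def)
  then show "conn G B `` (conn G A `` {v}) \<subseteq> conn G B `` {v}"
    using conn_mono[OF assms(1)] by (blast dest: transD)
  have "(v, v) \<in> conn G A" using assms(2) by (simp add: conn_def)
  then show "conn G B `` {v} \<subseteq> conn G B `` (conn G A `` {v})" by blast
qed

lemma num_components_antimono:
  assumes "A \<subseteq> B"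
  shows "num_components G B \<le> num_components G A"
proof -
  have "verts G // conn G B \<subseteq> (\<lambda>X. conn G B `` X) ` (verts G // conn G A)"
  proof
    fix Y assume "Y \<in> verts G // conn G B"
    then obtain v where v: "v \<in> verts G" and "Y = conn G B `` {v}" by (rule quotientE)
    then have "Y = conn G B `` (conn G A `` {v})" using conn_Image[OF assms v] by simp
    then show "Y \<in> (\<lambda>X. conn G B `` X) ` (verts G // conn G A)"
      using quotientI[OF v] by (rule image_eqI)
  qed
  then show ?thesis
    unfolding num_components_def using surj_card_le[OF finite_components] by blast
qed

lemma edge_rank_mono: "A \<subseteq> B \<Longrightarrow> edge_rank G A \<le> edge_rank G B"
  using num_components_antimono[of A B] by (simp add: edge_rank_def)

lemma num_components_insert:
  assumes "e \<in> edges G"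
  shows "num_components G A \<le> num_components G (insert e A) + 1"
proof -
  obtain a b where ab: "ends G e = {a, b}"
    using card_ends[OF assms] by (auto simp: card_2_iff card_1_singleton_iff)
  then have V: "a \<in> verts G" "b \<in> verts G" using ends_subset[OF assms] by auto
  define Q where "Q = verts G // conn G A"
  define f where "f X = conn G (insert e A) `` X" for X
  have "adj G (insert e A) = insert (a, b) (insert (b, a) (adj G A))"
    using ab by (auto simp: adj_def doubleton_eq_iff)
  have path: "(v, u) \<in> (adj G A)\<^sup>* \<or> (((v, a) \<in> (adj G A)\<^sup>* \<or> (v, b) \<in> (adj G A)\<^sup>*)
       \<and> ((a, u) \<in> (adj G A)\<^sup>* \<or> (b, u) \<in> (adj G A)\<^sup>*))"
    if "(v, u) \<in> (adj G (insert e A))\<^sup>*" for v u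
    using that
  proof induction
    case base
    then show ?case by simp
  next
    case (step y z)
    have "(y, z) \<in> adj G A \<or> (y = a \<and> z = b) \<or> (y = b \<and> z = a)"
      using step.hyps(2) unfolding \<open>adj G (insert e A) = _\<close> by auto
    then show ?case
      using step.IH rtrancl_into_rtrancl[of _ y "adj G A" z] by blast
  qed
  have cls: "conn G A `` {v} = conn G A `` {u}"
    if "(v, u) \<in> (adj G A)\<^sup>*" "v \<in> verts G" "u \<in> verts G" for u v
    using that equiv_conn[of A] by (intro equiv_class_eq) (auto simp: conn_def)
  have "inj_on f (Q - {conn G A `` {a}})"
  proof (rule inj_onI)
    fix X Y
    assume "X \<in> Q - {conn G A `` {a}}" "Y \<in> Q - {conn G A `` {a}}" and eq: "f X = f Y"
    then obtain x y where X: "X = conn G A `` {x}" "x \<in> verts G" "X \<noteq> conn G A `` {a}"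
      and Y: "Y = conn G A `` {y}" "y \<in> verts G" "Y \<noteq> conn G A `` {a}"
      unfolding Q_def by (auto simp: quotient_def)
    have "y \<in> f Y"
      using Y(2) unfolding f_def Y(1) by (auto simp: conn_def)
    then have "y \<in> f X" using eq by simp
    then obtain z where "z \<in> X" "(z, y) \<in> (adj G (insert e A))\<^sup>*"
      unfolding f_def by (auto simp: conn_def)
    then have z: "(x, z) \<in> (adj G A)\<^sup>*" "z \<in> verts G"
      and zy: "(z, y) \<in> (adj G (insert e A))\<^sup>*"
      unfolding X(1) by (auto simp: conn_def)
    have xz: "X = conn G A `` {z}" using cls[OF z(1) X(2) z(2)] X(1) by simp
    have "\<not> (z, a) \<in> (adj G A)\<^sup>*" using cls z(2) V xz X(3) by blast
    moreover have "\<not> (a, y) \<in> (adj G A)\<^sup>*" using cls Y V by blast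
    ultimately have "(z, y) \<in> (adj G A)\<^sup>* \<or> ((z, b) \<in> (adj G A)\<^sup>* \<and> (b, y) \<in> (adj G A)\<^sup>*)"
      using path[OF zy] by blast
    then have "(z, y) \<in> (adj G A)\<^sup>*" by (auto intro: rtrancl_trans)
    then show "X = Y" using cls[OF _ z(2) Y(2)] xz Y(1) by simp
  qed
  moreover have "f ` Q \<subseteq> verts G // conn G (insert e A)"
  proof -
    have "f (conn G A `` {v}) = conn G (insert e A) `` {v}" if "v \<in> verts G" for v
      unfolding f_def by (rule conn_Image[OF _ that]) auto
    then show ?thesis by (auto simp: Q_def quotient_def)
  qed
  ultimately have "card (Q - {conn G A `` {a}}) \<le> card (verts G // conn G (insert e A))"
    by (intro card_inj_on_le[of f]) (auto simp: finite_components)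
  moreover have "card Q \<le> card (Q - {conn G A `` {a}}) + 1"
    by (auto simp: card_Diff_singleton_if)
  ultimately show ?thesis by (simp add: num_components_def Q_def)
qed

lemma edge_rank_le_card:
  assumes "A \<subseteq> edges G"
  shows "edge_rank G A \<le> card A"
proof -
  have "finite A" using assms finite_edges finite_subset by blast
  then show ?thesis using assms
  proof induction
    case empty
    have "adj G {} = {}" by (simp add: adj_def)
    then have "verts G // conn G {} = (\<lambda>v. {v}) ` verts G"
      by (auto simp: quotient_def conn_def)
    then have "num_components G {} = card (verts G)"
      by (simp add: num_components_def card_image)
    then show ?case by (simp add: edge_rank_def)
  next
    case (insert e A)
    then show ?case using num_components_insert[of e A] by (simp add: edge_rank_def)
  qed
qed

end

definition Bias :: "'a measure \<Rightarrow> ('a \<Rightarrow> bool) \<Rightarrow> real" where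
  "Bias M P = \<P>(\<omega> in M. P \<omega>) - \<P>(\<omega> in M. \<not> P \<omega>)"

definition cond_Bias :: "'a measure \<Rightarrow> ('a \<Rightarrow> bool) \<Rightarrow> ('a \<Rightarrow> bool) \<Rightarrow> real" where
  "cond_Bias M P D = \<P>(\<omega> in M. P \<omega> \<bar> D \<omega>) - \<P>(\<omega> in M. \<not> P \<omega> \<bar> D \<omega>)"

definition random_edge_sets :: "('v, 'e) multigraph \<Rightarrow> ('e set \<times> 'e set) pmf" where
  "random_edge_sets G = pair_pmf (pmf_of_set (Pow (edges G))) (pmf_of_set (Pow (edges G)))"

end

theory Submission
  imports Defs
begin

text \<open>Let \<open>w\<close> be a primitive cube root of unity. As the residues 1 and 2 of \<open>|A| - |B|\<close> are equally
  likely, half of a difference of biases is the expectation of \<open>w ^ (|A| - |B|)\<close>. Fixing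
  \<open>C = sym_diff A B\<close> and summing over \<open>A\<close>, this character sum factors over the edges into
  \<open>(-1) ^ |C| * 2 ^ (|E| - |C|)\<close>. Hence the quotient of the theorem is, up to powers of 2, the
  generating function of the eulerian edge sets at \<open>t = -1/2\<close>. Inclusion of \<open>C\<close> in larger sets \<open>A\<close>,
  of which each contains \<open>2 ^ (|A| - r(A))\<close> eulerian subsets, turns this generating function into
  the Tutte polynomial at \<open>(1 / t, (1 + t) / (1 - t)) = (-2, 1/3)\<close>.\<close>

section \<open>The number of eulerian edge sets\<close>

context finite_multigraph
begin

section \<open>Rank change on adding one edge\<close>

lemma num_components_insert_conn:
  assumes "ends G e = {a, b}" "(a, b) \<in> (adj G A)\<^sup>*"
  shows "num_components G (insert e A) = num_components G A"
proof -
  have "(b, a) \<in> (adj G A)\<^sup>*"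
    using assms(2) sym_rtrancl[OF sym_adj[of A]] by (auto dest: symD)
  then have "adj G (insert e A) \<subseteq> (adj G A)\<^sup>*"
    using assms by (auto simp: adj_def doubleton_eq_iff intro: r_into_rtrancl)
  moreover have "adj G A \<subseteq> adj G (insert e A)"
    by (auto simp: adj_def)
  ultimately have "(adj G (insert e A))\<^sup>* = (adj G A)\<^sup>*"
    by (metis rtrancl_subset)
  then show ?thesis
    by (simp add: num_components_def conn_def)
qed

text \<open>The map \<open>f\<close> from the classes of \<open>A\<close> to those of the larger set
  merges the distinct classes of \<open>a\<close> and \<open>b\<close>, so it stays surjective
  without the class of \<open>b\<close>. This gives one inequality;
  \<open>num_components_insert\<close> gives the other.\<close>

lemma num_components_insert_not_conn:
  assumes "e \<in> edges G" "ends G e = {a, b}" "(a, b) \<notin> (adj G A)\<^sup>*"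
  shows "num_components G A = num_components G (insert e A) + 1"
proof -
  let ?Q = "verts G // conn G A" and ?B = "insert e A"
  define f where "f X = conn G ?B `` X" for X
  have V: "a \<in> verts G" "b \<in> verts G" using ends_subset[OF assms(1)] assms(2) by auto
  have f: "f (conn G A `` {v}) = conn G ?B `` {v}" if "v \<in> verts G" for v
    unfolding f_def by (rule conn_Image[OF _ that]) auto
  have "(a, b) \<in> conn G ?B"
    using V assms(2) by (auto simp: conn_def adj_def intro!: r_into_rtrancl)
  then have ab: "f (conn G A `` {a}) = f (conn G A `` {b})"
    using f V equiv_class_eq[OF equiv_conn] by simp
  have ne: "conn G A `` {a} \<noteq> conn G A `` {b}"
    using assms(3) V equiv_class_eq_iff[OF equiv_conn[of A], of a b] by (simp add: conn_def)
  have "verts G // conn G ?B \<subseteq> f ` (?Q - {conn G A `` {b}})"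
  proof
    fix Y assume "Y \<in> verts G // conn G ?B"
    then obtain v where v: "v \<in> verts G" and Y: "Y = conn G ?B `` {v}" by (rule quotientE)
    have *: "conn G A `` {w} \<in> ?Q" if "w \<in> verts G" for w using that by (rule quotientI)
    show "Y \<in> f ` (?Q - {conn G A `` {b}})"
    proof (cases "conn G A `` {v} = conn G A `` {b}")
      case True
      then have "Y = f (conn G A `` {a})" using f[OF v] Y ab by simp
      then show ?thesis using *[OF V(1)] ne by blast
    next
      case False
      then show ?thesis using f[OF v] Y *[OF v] by blast
    qed
  qed
  then have "num_components G ?B \<le> card (?Q - {conn G A `` {b}})"
    unfolding num_components_def by (intro surj_card_le finite_Diff finite_components)
  moreover have "card ?Q = Suc (card (?Q - {conn G A `` {b}}))"
    by (intro card.remove finite_components quotientI V)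
  ultimately show ?thesis
    using num_components_insert[OF assms(1), of A] by (simp add: num_components_def)
qed

lemma edge_rank_insert:
  assumes "e \<in> edges G" "ends G e = {a, b}"
  shows "edge_rank G (insert e A) = edge_rank G A + (if (a, b) \<in> (adj G A)\<^sup>* then 0 else 1)"
  using num_components_insert_conn[OF assms(2), of A] num_components_insert_not_conn[OF assms, of A]
    num_components_le[of A]
  by (auto simp: edge_rank_def)

lemma obtain_ends:
  assumes "e \<in> edges G"
  obtains a b where "ends G e = {a, b}"
  using card_ends[OF assms] by (auto simp: card_2_iff card_1_singleton_iff)

lemma finite_edge_set: "A \<subseteq> edges G \<Longrightarrow> finite A"
  by (rule finite_subset[OF _ finite_edges])

section \<open>Parity of degrees\<close>

lemma vertex_degree_eq_sum:
  assumes "finite A"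
  shows "vertex_degree G A v = (\<Sum>e\<in>A. of_bool (v \<in> ends G e) + of_bool (ends G e = {v}))"
  using assms by (simp add: vertex_degree_def sum.distrib of_bool_def sum.If_cases Int_def)

text \<open>Edges of \<open>A \<inter> B\<close> count twice in the sum of both degrees, so degree
  parity is linear over the field with two elements.\<close>

lemma even_vertex_degree_sym_diff:
  assumes "finite A" "finite B"
  shows "even (vertex_degree G (sym_diff A B) v) \<longleftrightarrow>
    (even (vertex_degree G A v) \<longleftrightarrow> even (vertex_degree G B v))"
proof -
  define w where "w e = (of_bool (v \<in> ends G e) + of_bool (ends G e = {v}) :: nat)" for e
  have deg: "vertex_degree G C v = sum w C" if "finite C" for C
    unfolding w_def using that by (rule vertex_degree_eq_sum)
  have "sum w (sym_diff A B) = sum w (A - B) + sum w (B - A)"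
    using assms by (intro sum.union_disjoint) auto
  moreover have "sum w A = sum w (A \<inter> B) + sum w (A - B)"
    using assms(1) by (rule sum.Int_Diff)
  moreover have "sum w B = sum w (A \<inter> B) + sum w (B - A)"
    using sum.Int_Diff[OF assms(2), of w A] by (simp only: Int_commute)
  ultimately show ?thesis
    using assms by (auto simp: deg)
qed

text \<open>For a loop, \<open>a = b\<close> and the right-hand side fails for every
  \<open>v\<close>, in accordance with degree 2. Loops thus need no separate case in what
  follows.\<close>

lemma odd_vertex_degree_single:
  assumes "ends G e = {a, b}"
  shows "odd (vertex_degree G {e} v) \<longleftrightarrow> (v = a) \<noteq> (v = b)"
  using assms by (auto simp: vertex_degree_eq_sum)

text \<open>Walking from \<open>a\<close> to \<open>b\<close>, each traversed edge is toggled in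
  \<open>P\<close>; this moves the odd end one step along. Edges traversed twice cancel, so the walk
  may repeat edges.\<close>

lemma obtain_trail:
  assumes "A \<subseteq> edges G" "(a, b) \<in> (adj G A)\<^sup>*"
  obtains P where "P \<subseteq> A" "\<And>v. odd (vertex_degree G P v) \<longleftrightarrow> (v = a) \<noteq> (v = b)"
proof -
  have "\<exists>P\<subseteq>A. \<forall>v. odd (vertex_degree G P v) \<longleftrightarrow> (v = a) \<noteq> (v = b)"
    using assms(2)
  proof induction
    case base
    have "vertex_degree G {} v = 0" for v by (simp add: vertex_degree_def)
    then show ?case by (intro exI[of _ "{}"]) simp
  next
    case (step y z)
    then obtain P e where P: "P \<subseteq> A" "\<And>v. odd (vertex_degree G P v) \<longleftrightarrow> (v = a) \<noteq> (v = y)"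
      and e: "e \<in> A" "ends G e = {y, z}"
      by (auto simp: adj_def)
    have "finite P" using P(1) assms(1) by (intro finite_edge_set) blast
    then have "odd (vertex_degree G (sym_diff P {e}) v) \<longleftrightarrow> (v = a) \<noteq> (v = z)" for v
      using even_vertex_degree_sym_diff[of P "{e}" v] P(2)[of v] odd_vertex_degree_single[OF e(2), of v]
      by simp blast
    then show ?case using P(1) e(1) by (intro exI[of _ "sym_diff P {e}"]) auto
  qed
  then show ?thesis using that by blast
qed

text \<open>Handshake by double counting: an edge inside \<open>K\<close> contributes 2 to the sum,
  an edge outside contributes 0.\<close>

lemma even_sum_vertex_degree:
  assumes "C \<subseteq> edges G" "K \<subseteq> verts G"
    and closed: "\<And>e. e \<in> C \<Longrightarrow> ends G e \<subseteq> K \<or> ends G e \<inter> K = {}"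
  shows "even (\<Sum>v\<in>K. vertex_degree G C v)"
proof -
  have K: "finite K" using assms(2) finite_verts finite_subset by blast
  have C: "finite C" using assms(1) by (rule finite_edge_set)
  have "even (\<Sum>v\<in>K. of_bool (v \<in> ends G e) + of_bool (ends G e = {v}) :: nat)" if e: "e \<in> C" for e
  proof (cases "ends G e \<subseteq> K")
    case False
    then have "ends G e \<inter> K = {}" using closed[OF e] by blast
    then show ?thesis by (intro dvd_sum) auto
  next
    case True
    have "(\<Sum>v\<in>K. of_bool (v \<in> ends G e) + of_bool (ends G e = {v})) =
        card (K \<inter> ends G e) + card (K \<inter> {v. ends G e = {v}})"
      using K by (simp add: sum.distrib of_bool_def sum.If_cases)
    moreover have "K \<inter> ends G e = ends G e" using True by blast
    moreover have "card (ends G e) = 1 \<or> card (ends G e) = 2"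
      using card_ends[of e] assms(1) e by auto
    \<comment> \<open>The two cardinalities add up to 1 + 1 for a loop and to 2 + 0 for any other
      edge.\<close>
    moreover have "K \<inter> {v. ends G e = {v}} = (if card (ends G e) = 1 then ends G e else {})"
      using True by (auto simp: card_1_singleton_iff)
    ultimately show ?thesis by auto
  qed
  then have "even (\<Sum>e\<in>C. \<Sum>v\<in>K. of_bool (v \<in> ends G e) + of_bool (ends G e = {v}) :: nat)"
    by (rule dvd_sum)
  then show ?thesis
    using C by (subst (asm) sum.swap) (simp add: vertex_degree_eq_sum)
qed

section \<open>The binary cycle space of an edge set\<close>

definition eulerian_subsets :: "'e set \<Rightarrow> 'e set set" where
  "eulerian_subsets A = {C. C \<subseteq> A \<and> eulerian G C}"

lemma finite_eulerian_subsets: "finite A \<Longrightarrow> finite (eulerian_subsets A)"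
  by (rule finite_subset[of _ "Pow A"]) (auto simp: eulerian_subsets_def)

lemma empty_in_eulerian_subsets: "{} \<in> eulerian_subsets A"
  by (simp add: eulerian_subsets_def eulerian_def vertex_degree_def)

lemma eulerian_sym_diff:
  assumes "finite C" "finite D" "eulerian G D"
  shows "eulerian G (sym_diff C D) \<longleftrightarrow> eulerian G C"
  using assms by (simp add: eulerian_def even_vertex_degree_sym_diff)

text \<open>Adding to \<open>e\<close> a trail in \<open>A\<close> between its ends gives an eulerian set, and the symmetric
  difference with it exchanges the eulerian sets avoiding \<open>e\<close> with those containing \<open>e\<close>.\<close>

lemma card_eulerian_subsets_insert_conn:
  assumes A: "insert e A \<subseteq> edges G" "e \<notin> A"
    and e: "ends G e = {a, b}" "(a, b) \<in> (adj G A)\<^sup>*"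
  shows "card (eulerian_subsets (insert e A)) = 2 * card (eulerian_subsets A)"
proof -
  obtain P where P: "P \<subseteq> A" "\<And>v. odd (vertex_degree G P v) \<longleftrightarrow> (v = a) \<noteq> (v = b)"
    using obtain_trail[OF _ e(2)] A(1) by blast
  define D where "D = sym_diff P {e}"
  have fin: "finite P" "finite A" using P(1) A(1) finite_edge_set by blast+
  then have D: "finite D" "eulerian G D" "e \<in> D" "D \<subseteq> insert e A"
    using P A odd_vertex_degree_single[OF e(1)]
    by (auto simp: D_def eulerian_def even_vertex_degree_sym_diff)
  let ?f = "\<lambda>C. sym_diff C D"
  have inj: "inj_on ?f (eulerian_subsets A)" by (auto simp: inj_on_def)
  have "eulerian_subsets (insert e A) = eulerian_subsets A \<union> ?f ` eulerian_subsets A"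
  proof (intro equalityI subsetI)
    fix C assume C: "C \<in> eulerian_subsets (insert e A)"
    then have "finite C" using fin by (auto simp: eulerian_subsets_def intro: finite_subset)
    show "C \<in> eulerian_subsets A \<union> ?f ` eulerian_subsets A"
    proof (cases "e \<in> C")
      case False
      then show ?thesis using C by (auto simp: eulerian_subsets_def)
    next
      case True
      then have "?f C \<in> eulerian_subsets A"
        using C D eulerian_sym_diff[OF \<open>finite C\<close> D(1,2)] by (auto simp: eulerian_subsets_def)
      moreover have "C = ?f (?f C)" by auto
      ultimately show ?thesis by (intro UnI2 image_eqI)
    qed
  next
    fix C assume "C \<in> eulerian_subsets A \<union> ?f ` eulerian_subsets A"
    then consider "C \<in> eulerian_subsets A" | C' where "C' \<in> eulerian_subsets A" "C = ?f C'" by blast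
    then show "C \<in> eulerian_subsets (insert e A)"
    proof cases
      case 1
      then show ?thesis by (auto simp: eulerian_subsets_def)
    next
      case 2
      then have "finite C'" using fin by (auto simp: eulerian_subsets_def intro: finite_subset)
      then show ?thesis
        using 2 D eulerian_sym_diff[OF \<open>finite C'\<close> D(1,2)] by (auto simp: eulerian_subsets_def)
    qed
  qed
  moreover have "eulerian_subsets A \<inter> ?f ` eulerian_subsets A = {}"
    using D(3) A(2) by (auto simp: eulerian_subsets_def)
  ultimately show ?thesis
    using finite_eulerian_subsets[OF fin(2)]
    by (simp add: card_Un_disjoint card_image[OF inj])
qed

text \<open>An eulerian set through a bridge \<open>e\<close> would leave, after deletion of \<open>e\<close>, a component with
  exactly one vertex of odd degree.\<close>

lemma eulerian_subsets_insert_not_conn: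
  assumes A: "insert e A \<subseteq> edges G" "e \<notin> A"
    and e: "ends G e = {a, b}" "(a, b) \<notin> (adj G A)\<^sup>*"
  shows "eulerian_subsets (insert e A) = eulerian_subsets A"
proof -
  have "e \<notin> C" if C: "C \<subseteq> insert e A" "eulerian G C" for C
  proof
    assume "e \<in> C"
    define D where "D = C - {e}"
    \<comment> \<open>This is the component of \<open>a\<close> in \<open>A\<close> rather than in
      \<open>D\<close>: it omits \<open>b\<close> by hypothesis, and as
      \<open>D \<subseteq> A\<close>, no edge of \<open>D\<close> leaves it.\<close>
    define K where "K = {v \<in> verts G. (a, v) \<in> (adj G A)\<^sup>*}"
    have D: "D \<subseteq> A" "D \<subseteq> edges G" "finite D" "C = sym_diff D {e}"
      using C A finite_edge_set[of D] \<open>e \<in> C\<close> by (auto simp: D_def)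
    have V: "a \<in> verts G" "b \<in> verts G" using ends_subset[of e] e(1) A(1) by auto
    have "odd (vertex_degree G D v) \<longleftrightarrow> v = a" if "v \<in> K" for v
    proof -
      have "v \<noteq> b" "a \<noteq> b" "v \<in> verts G" using that e(2) by (auto simp: K_def)
      then show ?thesis
        using C(2) odd_vertex_degree_single[OF e(1), of v] even_vertex_degree_sym_diff[of D "{e}" v] D(3)
        unfolding D(4) eulerian_def by auto
    qed
    moreover from this have "even (\<Sum>v\<in>K-{a}. vertex_degree G D v)"
      by (intro dvd_sum) auto
    moreover have K: "finite K" "a \<in> K" using V finite_verts by (auto simp: K_def)
    moreover have "(\<Sum>v\<in>K. vertex_degree G D v) =
        vertex_degree G D a + (\<Sum>v\<in>K-{a}. vertex_degree G D v)"
      using K by (rule sum.remove)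
    ultimately have "odd (\<Sum>v\<in>K. vertex_degree G D v)"
      by simp
    moreover have "even (\<Sum>v\<in>K. vertex_degree G D v)"
    proof (rule even_sum_vertex_degree[OF D(2)])
      show "K \<subseteq> verts G" by (auto simp: K_def)
    next
      fix d assume d: "d \<in> D"
      then obtain x y where xy: "ends G d = {x, y}"
        using obtain_ends D(2) by blast
      then have "(x, y) \<in> adj G A" "(y, x) \<in> adj G A" "x \<in> verts G" "y \<in> verts G"
        using d D(1,2) ends_subset[of d] by (auto simp: adj_def)
      then have "x \<in> K \<longleftrightarrow> y \<in> K"
        unfolding K_def using rtrancl_into_rtrancl[of a _ "adj G A"] by blast
      then show "ends G d \<subseteq> K \<or> ends G d \<inter> K = {}"
        using xy by auto
    qed
    ultimately show False by blast
  qed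
  then show ?thesis by (auto simp: eulerian_subsets_def)
qed

text \<open>Each new edge either doubles the number of eulerian subsets and keeps the rank, or keeps
  that number and raises the rank by one.\<close>

lemma card_eulerian_subsets:
  assumes "A \<subseteq> edges G"
  shows "card (eulerian_subsets A) * 2 ^ edge_rank G A = 2 ^ card A"
proof -
  have "finite A" using assms by (rule finite_edge_set)
  then show ?thesis using assms
  proof induction
    case empty
    have "eulerian_subsets {} = {{}}"
      using empty_in_eulerian_subsets[of "{}"] by (auto simp: eulerian_subsets_def)
    then show ?case using edge_rank_le_card[of "{}"] by simp
  next
    case (insert e A)
    then have "e \<in> edges G" by blast
    then obtain a b where e: "ends G e = {a, b}"
      by (rule obtain_ends)
    show ?case
      using insert card_eulerian_subsets_insert_conn[OF insert.prems insert.hyps(2) e]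
        eulerian_subsets_insert_not_conn[OF insert.prems insert.hyps(2) e]
        edge_rank_insert[OF \<open>e \<in> edges G\<close> e, of A]
      by (auto simp: mult.assoc)
  qed
qed

lemma card_eulerian_subsets_edges: "card (eulerian_subsets (edges G)) = 2 ^ nullity G"
proof -
  have "card (eulerian_subsets (edges G)) * 2 ^ graph_rank G = 2 ^ nullity G * 2 ^ graph_rank G"
    using card_eulerian_subsets[of "edges G"] edge_rank_le_card[of "edges G"]
    by (simp add: graph_rank_def nullity_def flip: power_add)
  then show ?thesis by simp
qed

section \<open>The generating function of the eulerian edge sets\<close>

text \<open>Writing the weight \<open>t\<close> or \<open>1\<close> of an edge as \<open>t + (0 or 1 - t)\<close> and expanding expresses
  \<open>t ^ card C\<close> as a sum over the supersets of \<open>C\<close>.\<close>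

lemma power_card_eq_sum_supersets:
  fixes t :: real
  assumes "finite E" "C \<subseteq> E"
  shows "t ^ card C =
    (\<Sum>A\<in>Pow E. if C \<subseteq> A then t ^ card A * (1 - t) ^ (card E - card A) else 0)"
proof -
  let ?g = "\<lambda>e. if e \<in> C then 0 else 1 - t"
  have "t ^ card C = (\<Prod>e\<in>E. if e \<in> C then t else 1)"
    using assms by (simp add: prod.If_cases Int_absorb1)
  also have "\<dots> = (\<Prod>e\<in>E. t + ?g e)"
    by (intro prod.cong) auto
  also have "\<dots> = (\<Sum>A\<in>Pow E. (\<Prod>e\<in>A. t) * (\<Prod>e\<in>E-A. ?g e))"
    using assms(1) by (rule prod_add)
  also have "\<dots> = (\<Sum>A\<in>Pow E. if C \<subseteq> A then t ^ card A * (1 - t) ^ (card E - card A) else 0)"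
  proof (intro sum.cong refl)
    fix A assume A: "A \<in> Pow E"
    then have fin: "finite A" "finite (E - A)" using assms(1) finite_subset by auto
    have "(\<Prod>e\<in>E-A. ?g e) = (if C \<subseteq> A then (1 - t) ^ (card E - card A) else 0)"
    proof (cases "C \<subseteq> A")
      case True
      then have "(\<Prod>e\<in>E-A. ?g e) = (\<Prod>e\<in>E-A. 1 - t)" by (intro prod.cong) auto
      then show ?thesis using True A fin by (simp add: card_Diff_subset)
    next
      case False
      then have "\<exists>e\<in>E-A. ?g e = 0" using assms(2) by auto
      then show ?thesis using False fin by (simp add: prod_zero)
    qed
    then show "(\<Prod>e\<in>A. t) * (\<Prod>e\<in>E-A. ?g e) =
        (if C \<subseteq> A then t ^ card A * (1 - t) ^ (card E - card A) else 0)"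
      by simp
  qed
  finally show ?thesis .
qed

text \<open>After exchanging the sums, each \<open>A\<close> carries the factor
  \<open>2 ^ (card A - edge_rank G A)\<close>. This matches the Tutte polynomial on the hyperbola (x
  - 1)(y - 1) = 2, of which x = 1/t, y = (1 + t)/(1 - t) is a parametrization.\<close>

theorem eulerian_generating_function:
  fixes t :: real
  assumes "t \<noteq> 0" "t \<noteq> 1"
  shows "(\<Sum>C\<in>eulerian_subsets (edges G). t ^ card C) =
    (1 - t) ^ nullity G * t ^ graph_rank G * tutte G (1 / t) ((1 + t) / (1 - t))"
proof -
  let ?E = "edges G"
  have "(\<Sum>C\<in>eulerian_subsets ?E. t ^ card C) =
    (\<Sum>C\<in>eulerian_subsets ?E. \<Sum>A\<in>Pow ?E.
      if C \<subseteq> A then t ^ card A * (1 - t) ^ (card ?E - card A) else 0)"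
    by (intro sum.cong refl power_card_eq_sum_supersets finite_edges)
      (auto simp: eulerian_subsets_def)
  also have "\<dots> = (\<Sum>A\<in>Pow ?E. \<Sum>C\<in>eulerian_subsets ?E.
      if C \<subseteq> A then t ^ card A * (1 - t) ^ (card ?E - card A) else 0)"
    by (rule sum.swap)
  also have "\<dots> = (\<Sum>A\<in>Pow ?E.
      real (card (eulerian_subsets A)) * (t ^ card A * (1 - t) ^ (card ?E - card A)))"
  proof (intro sum.cong refl)
    fix A assume "A \<in> Pow ?E"
    then have "eulerian_subsets ?E \<inter> {C. C \<subseteq> A} = eulerian_subsets A"
      by (auto simp: eulerian_subsets_def)
    then show "(\<Sum>C\<in>eulerian_subsets ?E.
        if C \<subseteq> A then t ^ card A * (1 - t) ^ (card ?E - card A) else 0) =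
        real (card (eulerian_subsets A)) * (t ^ card A * (1 - t) ^ (card ?E - card A))"
      by (simp add: sum.If_cases finite_eulerian_subsets finite_edges)
  qed
  also have "\<dots> = (\<Sum>A\<in>Pow ?E. (1 - t) ^ nullity G * t ^ graph_rank G *
      ((1 / t - 1) ^ (edge_rank G ?E - edge_rank G A) *
       ((1 + t) / (1 - t) - 1) ^ (card A - edge_rank G A)))"
  proof (intro sum.cong refl)
    fix A assume "A \<in> Pow ?E"
    then have A: "A \<subseteq> ?E" by blast
    obtain p where p: "edge_rank G ?E = edge_rank G A + p"
      using edge_rank_mono[OF A] le_Suc_ex by blast
    obtain q where q: "card A = edge_rank G A + q"
      using edge_rank_le_card[OF A] le_Suc_ex by blast
    obtain s where s: "card ?E = card A + s"
      using card_mono[OF finite_edges A] le_Suc_ex by blast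
    obtain n where n: "card ?E = edge_rank G ?E + n"
      using edge_rank_le_card[of ?E] le_Suc_ex by blast
    \<comment> \<open>Both sides are \<open>card ?E - edge_rank G A\<close>; this trades the
      exponents of the Tutte term for those of the expansion over supersets.\<close>
    have sn: "p + n = q + s" using p q s n by simp
    have "real (card (eulerian_subsets A)) * 2 ^ edge_rank G A = 2 ^ q * 2 ^ edge_rank G A"
      using arg_cong[OF card_eulerian_subsets[OF A], of real] q by (simp add: power_add)
    then have c: "real (card (eulerian_subsets A)) = 2 ^ q" by simp
    have x: "1 / t - 1 = (1 - t) / t" using assms by (simp add: field_simps)
    have y: "(1 + t) / (1 - t) - 1 = 2 * t / (1 - t)" using assms by (simp add: field_simps)
    have "(1 - t) ^ n * t ^ (edge_rank G A + p) * (((1 - t) / t) ^ p * (2 * t / (1 - t)) ^ q)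
        = (1 - t) ^ (p + n) * t ^ (edge_rank G A + q) * 2 ^ q / (1 - t) ^ q"
      using assms by (simp add: power_divide power_mult_distrib power_add field_simps)
    also have "\<dots> = 2 ^ q * (t ^ (edge_rank G A + q) * (1 - t) ^ s)"
      unfolding sn using assms by (simp add: power_add field_simps)
    finally show "real (card (eulerian_subsets A)) * (t ^ card A * (1 - t) ^ (card ?E - card A)) =
        (1 - t) ^ nullity G * t ^ graph_rank G *
        ((1 / t - 1) ^ (edge_rank G ?E - edge_rank G A) *
         ((1 + t) / (1 - t) - 1) ^ (card A - edge_rank G A))"
      using p q s n unfolding c x y by (simp add: nullity_def graph_rank_def)
  qed
  also have "\<dots> = (1 - t) ^ nullity G * t ^ graph_rank G * tutte G (1 / t) ((1 + t) / (1 - t))"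
    by (simp add: tutte_def sum_distrib_left)
  finally show ?thesis .
qed

end

section \<open>Pairs of sets with prescribed symmetric difference\<close>

text \<open>Two choices of \<open>\<C>\<close> matter: the eulerian edge sets, for the conditional
  biases, and \<open>Pow E\<close>, for the unconditional ones.\<close>

definition sym_diff_pairs :: "'e set \<Rightarrow> 'e set set \<Rightarrow> ('e set \<times> 'e set) set" where
  "sym_diff_pairs E \<C> = {(A, B). A \<subseteq> E \<and> B \<subseteq> E \<and> sym_diff A B \<in> \<C>}"

definition residue_pairs :: "'e set \<Rightarrow> 'e set set \<Rightarrow> nat \<Rightarrow> ('e set \<times> 'e set) set" where
  "residue_pairs E \<C> j = {(A, B) \<in> sym_diff_pairs E \<C>. [card A = card B + j] (mod 3)}"

lemma finite_sym_diff_pairs: "finite E \<Longrightarrow> finite (sym_diff_pairs E \<C>)"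
  by (rule finite_subset[of _ "Pow E \<times> Pow E"]) (auto simp: sym_diff_pairs_def)

text \<open>For fixed \<open>A\<close>, symmetric difference with \<open>A\<close> is an involution,
  so a pair may be recorded by \<open>A\<close> and \<open>C\<close> instead of \<open>A\<close> and
  \<open>B\<close>.\<close>

lemma sum_sym_diff_pairs:
  assumes "\<C> \<subseteq> Pow E"
  shows "(\<Sum>x\<in>sym_diff_pairs E \<C>. f x) = (\<Sum>C\<in>\<C>. \<Sum>A\<in>Pow E. f (A, sym_diff A C))"
proof -
  have "(\<Sum>x\<in>sym_diff_pairs E \<C>. f x) = (\<Sum>(C, A)\<in>\<C> \<times> Pow E. f (A, sym_diff A C))"
  proof (rule sum.reindex_bij_witness[where i = "\<lambda>(C, A). (A, sym_diff A C)"
        and j = "\<lambda>(A, B). (sym_diff A B, A)"])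
    fix x assume "x \<in> \<C> \<times> Pow E"
    moreover have "sym_diff A (sym_diff A C) = C" for A C :: "'a set" by blast
    ultimately show "(\<lambda>(C, A). (A, sym_diff A C)) x \<in> sym_diff_pairs E \<C>"
      "(\<lambda>(A, B). (sym_diff A B, A)) ((\<lambda>(C, A). (A, sym_diff A C)) x) = x"
      using assms by (auto simp: sym_diff_pairs_def)
  next
    fix x assume x: "x \<in> sym_diff_pairs E \<C>"
    have *: "sym_diff A (sym_diff A B) = B" for A B :: "'a set" by blast
    show "(\<lambda>(C, A). (A, sym_diff A C)) ((\<lambda>(A, B). (sym_diff A B, A)) x) = x"
      by (cases x) (simp add: *)
    show "(\<lambda>(A, B). (sym_diff A B, A)) x \<in> \<C> \<times> Pow E"
      using x by (auto simp: sym_diff_pairs_def)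
    show "(case (\<lambda>(A, B). (sym_diff A B, A)) x of (C, A) \<Rightarrow> f (A, sym_diff A C)) = f x"
      by (cases x) (simp add: *)
  qed
  then show ?thesis by (simp add: sum.cartesian_product)
qed

lemma card_sym_diff_pairs:
  assumes "finite E" "\<C> \<subseteq> Pow E"
  shows "card (sym_diff_pairs E \<C>) = card \<C> * 2 ^ card E"
  using sum_sym_diff_pairs[OF assms(2), of "\<lambda>_. 1 :: nat"] assms(1) by (simp add: card_Pow)

text \<open>Exchanging \<open>A\<close> and \<open>B\<close> keeps the symmetric difference and
  negates \<open>|A| - |B|\<close> modulo 3. This yields the first claim of the theorem and lets the
  coefficients of \<open>w\<close> and \<open>w\<^sup>2\<close> be combined below.\<close>

lemma card_residue_pairs_swap:
  "card (residue_pairs E \<C> 1) = card (residue_pairs E \<C> 2)"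
proof (rule bij_betw_same_card[of prod.swap])
  have *: "[a = b + 1] (mod 3) \<longleftrightarrow> [b = a + 2] (mod 3)" for a b :: nat
  proof -
    have "[a = b + 1] (mod 3) \<longleftrightarrow> [a + 2 = b + 1 + 2] (mod 3)"
      by (simp only: cong_add_rcancel_nat)
    also have "b + 1 + 2 = b + 1 * 3" by simp
    also have "[a + 2 = b + 1 * 3] (mod 3) \<longleftrightarrow> [a + 2 = b] (mod 3)"
      by (simp only: cong_def mod_mult_self1)
    finally show ?thesis by (simp only: cong_sym_eq)
  qed
  have swap: "prod.swap x \<in> residue_pairs E \<C> 2 \<longleftrightarrow> x \<in> residue_pairs E \<C> 1" for x
  proof (cases x)
    case (Pair A B)
    then show ?thesis
      using *[of "card A" "card B"] Un_commute[of "A - B" "B - A"]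
      by (simp only: residue_pairs_def sym_diff_pairs_def swap_simp mem_Collect_eq case_prod_conv) blast
  qed
  show "bij_betw prod.swap (residue_pairs E \<C> 1) (residue_pairs E \<C> 2)"
  proof (rule bij_betwI[where g = prod.swap])
    show "prod.swap \<in> residue_pairs E \<C> 2 \<rightarrow> residue_pairs E \<C> 1"
      using swap[of "prod.swap x" for x] by simp
  qed (simp_all add: swap)
qed

text \<open>A character sum: with \<open>w\<close> a primitive cube root of unity, \<open>w\<^sup>2 = 1 / w\<close> and
  \<open>w + w\<^sup>2 = -1\<close>. An edge of \<open>C\<close> lies in exactly one of \<open>A\<close> and \<open>sym_diff A C\<close> and contributes
  the factor \<open>w + w\<^sup>2\<close>; any other edge contributes \<open>1 + w * w\<^sup>2 = 2\<close>.\<close>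

lemma sum_cube_root_powers:
  fixes w :: "'a :: comm_ring_1"
  assumes w: "1 + w + w\<^sup>2 = 0" and "finite E" "C \<subseteq> E"
  shows "(\<Sum>A\<in>Pow E. w ^ (card A + 2 * card (sym_diff A C))) =
    (-1) ^ card C * 2 ^ (card E - card C)"
proof -
  have w2: "w + w\<^sup>2 = -1" using w by (simp add: add_eq_0_iff algebra_simps)
  have w3: "w * w\<^sup>2 = 1"
  proof -
    have "w * w\<^sup>2 - 1 = (w - 1) * (1 + w + w\<^sup>2)" by (simp add: algebra_simps power2_eq_square)
    then show ?thesis using w by simp
  qed
  \<comment> \<open>\<open>?f e\<close> is the factor of an edge \<open>e\<close> in
    \<open>A\<close>, \<open>?g e\<close> that of an edge outside; \<open>w\<^sup>2\<close> occurs
    exactly when \<open>e\<close> lies in \<open>sym_diff A C\<close>.\<close>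
  let ?f = "\<lambda>e. w * (if e \<in> C then 1 else w\<^sup>2)" and ?g = "\<lambda>e. if e \<in> C then w\<^sup>2 else 1"
  have "(\<Sum>A\<in>Pow E. w ^ (card A + 2 * card (sym_diff A C))) =
      (\<Sum>A\<in>Pow E. (\<Prod>e\<in>A. ?f e) * (\<Prod>e\<in>E-A. ?g e))"
  proof (intro sum.cong refl)
    fix A assume "A \<in> Pow E"
    then have A: "A \<subseteq> E" "finite A" using assms(2) finite_subset by auto
    have "card (sym_diff A C) = card (A - C) + card (C - A)"
      using A assms finite_subset by (intro card_Un_disjoint) auto
    moreover have "(\<Prod>e\<in>A. ?f e) = w ^ card A * (w\<^sup>2) ^ card (A - C)"
      using A by (simp add: prod.distrib prod.If_cases Diff_eq)
    moreover have "(\<Prod>e\<in>E-A. ?g e) = (w\<^sup>2) ^ card (C - A)"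
    proof -
      have "(E - A) \<inter> C = C - A" using assms(3) by blast
      then show ?thesis using assms(2) by (simp add: prod.If_cases)
    qed
    ultimately show "w ^ (card A + 2 * card (sym_diff A C)) =
        (\<Prod>e\<in>A. ?f e) * (\<Prod>e\<in>E-A. ?g e)"
      by (simp only: power_add power_mult mult.assoc)
  qed
  also have "\<dots> = (\<Prod>e\<in>E. ?f e + ?g e)"
    using assms(2) by (rule prod_add[symmetric])
  also have "\<dots> = (\<Prod>e\<in>E. if e \<in> C then -1 else 2)"
    using w2 w3 by (intro prod.cong) auto
  also have "\<dots> = (-1) ^ card C * 2 ^ card (E - C)"
    using assms by (simp add: prod.If_cases Int_absorb1 Diff_eq)
  also have "card (E - C) = card E - card C"
    using assms finite_subset by (intro card_Diff_subset) auto
  finally show ?thesis .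
qed

text \<open>Modulo 3, \<open>2 * b\<close> stands for \<open>-b\<close>, so a natural number can
  serve as the exponent of \<open>w\<close> for \<open>|A| - |B|\<close>.\<close>

lemma cong_add_iff_mod_3:
  fixes a b j :: nat
  assumes "j < 3"
  shows "[a = b + j] (mod 3) \<longleftrightarrow> (a + 2 * b) mod 3 = j"
proof -
  have "[a = b + j] (mod 3) \<longleftrightarrow> [a + 2 * b = b + j + 2 * b] (mod 3)"
    by (simp only: cong_add_rcancel_nat)
  also have "b + j + 2 * b = j + b * 3" by simp
  finally show ?thesis using assms by (simp add: cong_def)
qed

text \<open>Grouping the character sum by residues gives N0 + N1 w + N2 w^2, where Nj is the number
  of pairs of residue j. As N1 = N2 and w + w^2 = -1, this is N0 - N1. Grouping it by
  \<open>C\<close> instead gives the right-hand side.\<close>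

lemma card_residue_pairs_diff:
  assumes "finite E" "\<C> \<subseteq> Pow E"
  shows "real (card (residue_pairs E \<C> 0)) - real (card (residue_pairs E \<C> 1)) =
    (\<Sum>C\<in>\<C>. (-1) ^ card C * 2 ^ (card E - card C))"
proof -
  define w where "w = Complex (- 1 / 2) (sqrt 3 / 2)"
  have w: "1 + w + w\<^sup>2 = 0"
    by (simp add: w_def complex_eq_iff power2_eq_square field_simps)
  have w3: "w ^ 3 = 1"
    by (simp add: w_def complex_eq_iff power3_eq_cube field_simps)
  let ?h = "\<lambda>(A, B). w ^ (card A + 2 * card B) :: complex"
  let ?R = "residue_pairs E \<C>" and ?S = "sym_diff_pairs E \<C>"
  have wmod: "w ^ k = w ^ (k mod 3)" for k
  proof -
    have "w ^ k = w ^ (3 * (k div 3) + k mod 3)" by simp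
    then show ?thesis by (simp only: power_add power_mult w3) simp
  qed
  let ?k = "\<lambda>(A, B). (card A + 2 * card B) mod 3"
  have R: "?R j = {x \<in> ?S. ?k x = j}" if "j < 3" for j
    using that cong_add_iff_mod_3 by (auto simp: residue_pairs_def)
  have h: "sum ?h (?R j) = of_nat (card (?R j)) * w ^ j" if "j < 3" for j
  proof -
    have "?h x = w ^ j" if "x \<in> ?R j" for x
    proof -
      have "?h x = w ^ ?k x" by (cases x) (simp flip: wmod)
      also have "?k x = j" using that unfolding R[OF \<open>j < 3\<close>] by blast
      finally show ?thesis .
    qed
    then show ?thesis by simp
  qed
  have "sum ?h ?S = (\<Sum>j<3. sum ?h {x \<in> ?S. ?k x = j})"
    using finite_sym_diff_pairs[OF assms(1)] by (intro sum.group[symmetric]) auto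
  also have "\<dots> = (\<Sum>j<3. sum ?h (?R j))"
    using R by (intro sum.cong) auto
  also have "\<dots> = sum ?h (?R 0) + (sum ?h (?R 1) + sum ?h (?R 2))"
    by (simp add: numeral_3_eq_3 numeral_2_eq_2)
  also have "\<dots> = of_nat (card (?R 0)) + of_nat (card (?R 1)) * (w + w\<^sup>2)"
    using h[of 0] h[of 1] h[of 2] card_residue_pairs_swap[of E \<C>] by (simp add: distrib_left)
  also have "w + w\<^sup>2 = -1" using w by (simp add: add_eq_0_iff algebra_simps)
  finally have "of_nat (card (?R 0)) - of_nat (card (?R 1)) = sum ?h ?S" by simp
  also have "\<dots> = (\<Sum>C\<in>\<C>. \<Sum>A\<in>Pow E. w ^ (card A + 2 * card (sym_diff A C)))"
    using sum_sym_diff_pairs[OF assms(2), of ?h] by simp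
  also have "\<dots> = (\<Sum>C\<in>\<C>. (-1) ^ card C * 2 ^ (card E - card C))"
    using assms by (intro sum.cong refl sum_cube_root_powers[OF w]) auto
  also have "\<dots> = complex_of_real (\<Sum>C\<in>\<C>. (-1) ^ card C * 2 ^ (card E - card C))"
    by simp
  finally have "complex_of_real (real (card (?R 0)) - real (card (?R 1))) =
      complex_of_real (\<Sum>C\<in>\<C>. (-1) ^ card C * 2 ^ (card E - card C))"
    by simp
  then show ?thesis by (rule of_real_eq_iff[THEN iffD1])
qed

section \<open>Biases\<close>

lemma (in prob_space) cond_Bias_eq:
  assumes "{\<omega> \<in> space M. P \<omega> \<and> D \<omega>} \<in> events" "{\<omega> \<in> space M. D \<omega>} \<in> events"
    and "\<P>(\<omega> in M. D \<omega>) \<noteq> 0"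
  shows "cond_Bias M P D = 2 * \<P>(\<omega> in M. P \<omega> \<and> D \<omega>) / \<P>(\<omega> in M. D \<omega>) - 1"
proof -
  have "{\<omega> \<in> space M. \<not> P \<omega> \<and> D \<omega>} = {\<omega> \<in> space M. D \<omega>} - {\<omega> \<in> space M. P \<omega> \<and> D \<omega>}"
    by blast
  then have "\<P>(\<omega> in M. \<not> P \<omega> \<and> D \<omega>) = \<P>(\<omega> in M. D \<omega>) - \<P>(\<omega> in M. P \<omega> \<and> D \<omega>)"
    using assms(1,2) by (simp add: finite_measure_Diff subset_iff)
  then show ?thesis
    using assms(3) by (simp add: cond_Bias_def cond_prob_def field_simps)
qed

text \<open>Conditioning on the sure event makes the unconditional biases a special case of
  \<open>cond_Bias_residue\<close>.\<close>

lemma (in prob_space) Bias_eq_cond_Bias: "Bias M P = cond_Bias M P (\<lambda>_. True)"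
  by (simp add: Bias_def cond_Bias_def cond_prob_def prob_space)

context finite_multigraph
begin

section \<open>Biases as counts of pairs\<close>

lemma prob_random_edge_sets:
  "\<P>(\<omega> in measure_pmf (random_edge_sets G). P \<omega>) =
    real (card {\<omega> \<in> Pow (edges G) \<times> Pow (edges G). P \<omega>}) / 4 ^ card (edges G)"
proof -
  let ?E = "edges G"
  have fin: "finite (Pow ?E)" "Pow ?E \<noteq> {}" using finite_edges by auto
  have fin2: "finite (Pow ?E \<times> Pow ?E)" "Pow ?E \<times> Pow ?E \<noteq> {}" using finite_edges by auto
  have "random_edge_sets G = pmf_of_set (Pow ?E \<times> Pow ?E)"
  proof (rule pmf_eqI)
    fix x :: "'e set \<times> 'e set"
    show "pmf (random_edge_sets G) x = pmf (pmf_of_set (Pow ?E \<times> Pow ?E)) x"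
      unfolding random_edge_sets_def
      by (cases x) (simp only: pmf_pair pmf_of_set[OF fin(2,1)] pmf_of_set[OF fin2(2,1)]
          indicator_times card_cartesian_product fst_conv snd_conv of_nat_mult times_divide_times_eq)
  qed
  moreover note fin2
  moreover have "card (Pow ?E \<times> Pow ?E) = 4 ^ card ?E"
    using finite_edges by (simp add: card_cartesian_product card_Pow flip: power_mult_distrib)
  ultimately show ?thesis
    by (simp add: measure_pmf_of_set Int_def)
qed

text \<open>The common factor \<open>4 ^ card (edges G)\<close> of the probabilities cancels, which
  leaves counts of pairs. Nonemptiness of \<open>\<C>\<close> gives the conditioning event positive
  probability.\<close>

lemma cond_Bias_residue:
  fixes D
  defines "\<C> \<equiv> {C. C \<subseteq> edges G \<and> D C}"
  assumes "\<C> \<noteq> {}"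
  shows "cond_Bias (measure_pmf (random_edge_sets G)) (\<lambda>(A, B). [card A = card B + j] (mod 3))
      (\<lambda>(A, B). D (sym_diff A B)) =
    2 * real (card (residue_pairs (edges G) \<C> j)) / (real (card \<C>) * 2 ^ card (edges G)) - 1"
proof -
  let ?E = "edges G" and ?M = "measure_pmf (random_edge_sets G)"
  let ?D = "\<lambda>(A, B). D (sym_diff A B)" and ?P = "\<lambda>(A, B). [card A = card B + j] (mod 3)"
  have \<C>: "\<C> \<subseteq> Pow ?E" "finite \<C>" using finite_edges by (auto simp: \<C>_def)
  have "{\<omega> \<in> Pow ?E \<times> Pow ?E. ?D \<omega>} = sym_diff_pairs ?E \<C>"
    by (auto simp: sym_diff_pairs_def \<C>_def)
  then have D: "\<P>(\<omega> in ?M. ?D \<omega>) = real (card \<C>) * 2 ^ card ?E / 4 ^ card ?E"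
    using prob_random_edge_sets[of ?D] card_sym_diff_pairs[OF finite_edges \<C>(1)] by simp
  have "{\<omega> \<in> Pow ?E \<times> Pow ?E. ?P \<omega> \<and> ?D \<omega>} = residue_pairs ?E \<C> j"
    by (auto simp: sym_diff_pairs_def residue_pairs_def \<C>_def)
  then have P: "\<P>(\<omega> in ?M. ?P \<omega> \<and> ?D \<omega>) = real (card (residue_pairs ?E \<C> j)) / 4 ^ card ?E"
    using prob_random_edge_sets[of "\<lambda>\<omega>. ?P \<omega> \<and> ?D \<omega>"] by simp
  have "\<P>(\<omega> in ?M. ?D \<omega>) \<noteq> 0" using assms(2) \<C>(2) unfolding D by simp
  then have "cond_Bias ?M ?P ?D = 2 * \<P>(\<omega> in ?M. ?P \<omega> \<and> ?D \<omega>) / \<P>(\<omega> in ?M. ?D \<omega>) - 1"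
    by (intro measure_pmf.cond_Bias_eq) auto
  then show ?thesis unfolding D P by simp
qed

text \<open>For \<open>\<C> = Pow (edges G)\<close> the sum of
  \<open>card_residue_pairs_diff\<close> expands (-1 + 2)^|E| = 1. In particular, the denominator in
  the theorem is not zero.\<close>

lemma Bias_residue_diff:
  "Bias (measure_pmf (random_edge_sets G)) (\<lambda>(A, B). [card A = card B + 0] (mod 3)) -
    Bias (measure_pmf (random_edge_sets G)) (\<lambda>(A, B). [card A = card B + 1] (mod 3)) =
    2 / 4 ^ card (edges G)"
proof -
  let ?E = "edges G"
  have bias: "Bias (measure_pmf (random_edge_sets G)) (\<lambda>(A, B). [card A = card B + j] (mod 3)) =
    2 * real (card (residue_pairs ?E (Pow ?E) j)) / 4 ^ card ?E - 1" for j
  proof -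
    have "(2 :: real) ^ card ?E * 2 ^ card ?E = 4 ^ card ?E" by (simp flip: power_mult_distrib)
    moreover have "{C. C \<subseteq> ?E \<and> True} = Pow ?E" by auto
    moreover have "(\<lambda>(A :: 'e set, B :: 'e set). True) = (\<lambda>_. True)" by auto
    ultimately show ?thesis
      using cond_Bias_residue[of "\<lambda>_. True" j] finite_edges
      by (auto simp: measure_pmf.Bias_eq_cond_Bias card_Pow)
  qed
  have "real (card (residue_pairs ?E (Pow ?E) 0)) - real (card (residue_pairs ?E (Pow ?E) 1)) = 1"
  proof -
    have "(\<Sum>C\<in>Pow ?E. (-1 :: real) ^ card C * 2 ^ (card ?E - card C)) =
      (\<Sum>C\<in>Pow ?E. (\<Prod>e\<in>C. -1) * (\<Prod>e\<in>?E-C. 2))"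
      using finite_edge_set by (intro sum.cong) (auto simp: card_Diff_subset)
    also have "\<dots> = (\<Prod>e\<in>?E. -1 + 2)"
      using finite_edges by (rule prod_add[symmetric])
    finally show ?thesis
      using card_residue_pairs_diff[OF finite_edges, of "Pow ?E"] by simp
  qed
  then show ?thesis
    unfolding bias by (simp add: field_simps)
qed

end

section \<open>Evaluation at t = -1/2\<close>

theorem theorem2p14:
  fixes G :: "('v, 'e) multigraph"
  assumes "finite_multigraph G"
  shows "let M = measure_pmf (random_edge_sets G);
             \<Delta> = (\<lambda>(A, B). eulerian G (sym_diff A B));
             S = (\<lambda>j (A, B). [card A = card B + j] (mod 3))
         in cond_Bias M (S 1) \<Delta> = cond_Bias M (S 2) \<Delta>
          \<and> (cond_Bias M (S 0) \<Delta> - cond_Bias M (S 1) \<Delta>) / (Bias M (S 0) - Bias M (S 1))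
              = (-2) ^ graph_rank G * 3 ^ nullity G * tutte G (-2) (1 / 3)"
proof -
  interpret finite_multigraph G by fact
  let ?E = "edges G" and ?M = "measure_pmf (random_edge_sets G)"
  let ?D = "\<lambda>(A, B). eulerian G (sym_diff A B)"
  let ?S = "\<lambda>j (A, B). [card A = card B + j] (mod 3)"
  define \<C> where "\<C> = eulerian_subsets ?E"
  have \<C>: "\<C> \<subseteq> Pow ?E" "\<C> \<noteq> {}" "{C. C \<subseteq> ?E \<and> eulerian G C} = \<C>"
    using empty_in_eulerian_subsets[of ?E] by (auto simp: \<C>_def eulerian_subsets_def)
  let ?N = "\<lambda>j. real (card (residue_pairs ?E \<C> j))"
  have bias: "cond_Bias ?M (?S j) ?D = 2 * ?N j / (2 ^ nullity G * 2 ^ card ?E) - 1" for j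
    using cond_Bias_residue[of "eulerian G" j] \<C> card_eulerian_subsets_edges by (simp add: \<C>_def)
  have m: "card ?E = graph_rank G + nullity G"
    using edge_rank_le_card[of ?E] by (simp add: graph_rank_def nullity_def)
  let ?T = "tutte G (-2) (1 / 3)"
  have "?N 0 - ?N 1 = (\<Sum>C\<in>\<C>. (-1) ^ card C * 2 ^ (card ?E - card C))"
    by (rule card_residue_pairs_diff[OF finite_edges \<C>(1)])
  also have "\<dots> = (\<Sum>C\<in>\<C>. 2 ^ card ?E * (-1 / 2) ^ card C)"
  proof (intro sum.cong refl)
    fix C assume "C \<in> \<C>"
    then have "card C \<le> card ?E" using \<C>(1) card_mono[OF finite_edges] by blast
    moreover have "(-1 / 2 :: real) ^ card C = (-1) ^ card C / 2 ^ card C"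
      by (rule power_divide)
    ultimately show "(-1) ^ card C * 2 ^ (card ?E - card C) = 2 ^ card ?E * (-1 / 2 :: real) ^ card C"
      by (simp add: power_diff)
  qed
  \<comment> \<open>At t = -1/2 the constants are 1 - t = 3/2, 1/t = -2 and (1 + t)/(1 - t) =
    1/3.\<close>
  also have "\<dots> = 2 ^ card ?E * ((3 / 2) ^ nullity G * (-1 / 2) ^ graph_rank G * ?T)"
    using eulerian_generating_function[of "-1 / 2"] by (simp add: \<C>_def flip: sum_distrib_left)
  finally have N: "?N 0 - ?N 1 = 2 ^ card ?E * ((3 / 2) ^ nullity G * (-1 / 2) ^ graph_rank G * ?T)" .
  have "cond_Bias ?M (?S 0) ?D - cond_Bias ?M (?S 1) ?D =
      2 * (?N 0 - ?N 1) / (2 ^ nullity G * 2 ^ card ?E)"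
    unfolding bias by (simp add: diff_divide_distrib right_diff_distrib)
  also have "\<dots> = 2 * ((3 / 2) ^ nullity G * (-1 / 2) ^ graph_rank G * ?T) / 2 ^ nullity G"
    unfolding N by simp
  finally have "(cond_Bias ?M (?S 0) ?D - cond_Bias ?M (?S 1) ?D) / (Bias ?M (?S 0) - Bias ?M (?S 1))
      = 4 ^ card ?E * ((3 / 2) ^ nullity G * (-1 / 2) ^ graph_rank G * ?T) / 2 ^ nullity G"
    unfolding Bias_residue_diff by simp
  \<comment> \<open>Splitting |E| into rank and nullity collects the constants: 4 * (-1/2) = -2 per
    unit of rank and 4 * (3/2) / 2 = 3 per unit of nullity.\<close>
  also have "\<dots> = (4 ^ graph_rank G * (-1 / 2) ^ graph_rank G) *
      (4 ^ nullity G * (3 / 2) ^ nullity G / 2 ^ nullity G) * ?T"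
    by (simp only: m power_add mult_ac times_divide_eq_left times_divide_eq_right)
  also have "(4 :: real) ^ r * (-1 / 2) ^ r = (-2) ^ r" for r
    by (simp flip: power_mult_distrib)
  also have "(4 :: real) ^ n * (3 / 2) ^ n / 2 ^ n = 3 ^ n" for n
    by (simp flip: power_mult_distrib power_divide)
  finally have "(cond_Bias ?M (?S 0) ?D - cond_Bias ?M (?S 1) ?D) / (Bias ?M (?S 0) - Bias ?M (?S 1))
      = (-2) ^ graph_rank G * 3 ^ nullity G * ?T" .
  moreover have "cond_Bias ?M (?S 1) ?D = cond_Bias ?M (?S 2) ?D"
    unfolding bias card_residue_pairs_swap ..
  ultimately show ?thesis
    unfolding Let_def by blast
qed

end
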